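(* Let $V\subset\mathbb{C}^n$ be a linear space that does not lie in any coordinate hyperplane, let $\mathcal{H}\subset V$ be the central arrangement of hyperplanes given by the coordinates of $\mathbb{C}^n$, and let $\mathcal{H}^c:=V\smallsetminus\mathcal{H}=V\cap(\mathbb{C}^\times)^n$ be its complement. Then the phase limit set of $\mathcal{H}^c$ in $\mathbb{T}^n$ is $$\mathscr{P}^\infty(\mathcal{H}^c)\;=\;\bigcup_{L}\Bigl(\overline{c\mathscr{A}\bigl((\mathcal{H}/L)^c\bigr)}\times c\mathscr{A}\bigl((\mathcal{H}|_L)^c\bigr)\Bigr),$$ the union over all nonzero proper flats $L$ of $\mathcal{H}$, where $\mathcal{H}/L$ is the contraction of $\mathcal{H}$ by $L$ and $\mathcal{H}|_L$ is the restriction of $\mathcal{H}$ to $L$.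
   Context: $\mathbb{T}\subset\mathbb{C}$ is the unit circle; $\mathrm{Arg}\colon(\mathbb{C}^\times)^n\to\mathbb{T}^n$ is $z\mapsto(z_1/|z_1|,\dots,z_n/|z_n|)$. The coamoeba of $X\subset(\mathbb{C}^\times)^n$ is $c\mathscr{A}(X):=\mathrm{Arg}(X)$. The phase limit set $\mathscr{P}^\infty(X)\subset\mathbb{T}^n$ of a subvariety $X\subset(\mathbb{C}^\times)^n$ is the collection of all accumulation points of sequences of arguments $\{\mathrm{Arg}(x_i)\mid i\in\mathbb{N}\}$ where $\{x_i\mid i\in\mathbb{N}\}\subset X$ is unbounded. Let $B=\{b_1,\dots,b_n\}\subset V^*$ be the multiset of restrictions to $V$ of the coordinate functions (all nonzero, spanning $V^*$). A flat of $\mathcal{H}$ is a linear subspace $L\subset V$ that is an intersection of hyperplanes of $\mathcal{H}$ ($V$ itself being the empty intersection). For a flat $L$ put $F:=\{b\in B: b|_L\equiv 0\}$ and $F^c:=B\smallsetminus F$. The forms in $F$ define an arrangement $\mathcal{H}/L$ in $V/L$ (the contraction), and $(\mathcal{H}/L)^c\subset(\mathbb{C}^\times)^F$ is the image of its complement under $v\mapsto(\langle b,v\rangle)_{b\in F}$. The forms in $F^c$ restricted to $L$ define an arrangement $\mathcal{H}|_L$ in $L$ (the restriction), and $(\mathcal{H}|_L)^c\subset(\mathbb{C}^\times)^{F^c}$ is the image of its complement under $v\mapsto(\langle b,v\rangle)_{b\in F^c}$. Products lie in $\mathbb{T}^F\times\mathbb{T}^{F^c}=\mathbb{T}^n$.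
   Formalization: "Unbounded" in the phase limit set is read as leaving every compact subset of the torus modulo scalars c with cX = X; read literally the formula fails, e.g. for V = ℂ (n = 1), where the phase limit set is 𝕋 but there are no nonzero proper flats. *)

theory Defs
  imports "HOL-Analysis.Analysis"
begin

(* Points of (C - {0})^I, for a set I of coordinates, are functions that are extensional on I.
   The topology is the product topology on 'n => complex; the functions extensional on I form
   a closed subset of it, so closures and limits agree with those taken in (C - {0})^I and T^I. *)
definition algebraic_torus :: "'n set \<Rightarrow> ('n \<Rightarrow> complex) set" where
  "algebraic_torus I = PiE I (\<lambda>_. - {0})"

definition torus_arg :: "'n set \<Rightarrow> ('n \<Rightarrow> complex) \<Rightarrow> 'n \<Rightarrow> complex" where
  "torus_arg I z = (\<lambda>i\<in>I. z i / complex_of_real (cmod (z i)))"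

definition coamoeba :: "'n set \<Rightarrow> ('n \<Rightarrow> complex) set \<Rightarrow> ('n \<Rightarrow> complex) set" where
  "coamoeba I X = torus_arg I ` X"

definition scale_by :: "complex \<Rightarrow> ('n \<Rightarrow> complex) \<Rightarrow> 'n \<Rightarrow> complex" where
  "scale_by c z = (\<lambda>i. c * z i)"

(* A sequence in X is unbounded if it leaves every compact subset of the torus, where scalars
   preserving X are divided out.  If X is a subvariety that is not homogeneous, only finitely
   many scalars (roots of unity) preserve X, and this is the usual notion.  If X is homogeneous,
   as is the complement of a central arrangement, it says that the sequence is unbounded in
   the projective torus (C - {0})^n / (C - {0}).  Without this, k |-> k x would count as unbounded for
   every x in a homogeneous X, and every point of the coamoeba would be a phase limit. *)
definition unbounded_seq :: "('n \<Rightarrow> complex) set \<Rightarrow> (nat \<Rightarrow> 'n \<Rightarrow> complex) \<Rightarrow> bool" where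
  "unbounded_seq X x \<longleftrightarrow>
     (\<forall>K. compact K \<and> K \<subseteq> algebraic_torus UNIV \<longrightarrow>
       (\<forall>\<^sub>F k in sequentially.
          \<forall>c. c \<noteq> 0 \<and> scale_by c ` X = X \<longrightarrow> scale_by c (x k) \<notin> K))"

definition phase_limit_set :: "('n \<Rightarrow> complex) set \<Rightarrow> ('n \<Rightarrow> complex) set" where
  "phase_limit_set X =
     {\<theta>. \<exists>x r. (\<forall>k. x k \<in> X) \<and> unbounded_seq X x \<and> strict_mono (r :: nat \<Rightarrow> nat) \<and>
           (\<lambda>k. torus_arg UNIV (x (r k))) \<longlonglongrightarrow> \<theta>}"

(* The image in (C - {0})^I, under the coordinate forms with index in I, of the complement in W of
   the arrangement that these forms define. *)
definition complement_image :: "(complex ^ 'n) set \<Rightarrow> 'n set \<Rightarrow> ('n \<Rightarrow> complex) set" where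
  "complement_image W I = {(\<lambda>i\<in>I. v $ i) | v. v \<in> W \<and> (\<forall>i\<in>I. v $ i \<noteq> 0)}"

definition arrangement :: "(complex ^ 'n) set \<Rightarrow> (complex ^ 'n) set set" where
  "arrangement V = range (\<lambda>i. {v \<in> V. v $ i = 0})"

definition arrangement_complement :: "(complex ^ 'n) set \<Rightarrow> ('n \<Rightarrow> complex) set" where
  "arrangement_complement V = complement_image V UNIV"

definition flats :: "(complex ^ 'n) set \<Rightarrow> (complex ^ 'n) set set" where
  "flats V = {V \<inter> \<Inter>\<C> | \<C>. \<C> \<subseteq> arrangement V}"

definition vanishing_forms :: "(complex ^ 'n) set \<Rightarrow> 'n set" where
  "vanishing_forms L = {i. \<forall>v\<in>L. v $ i = 0}"

(* The forms in vanishing_forms L are constant on the cosets of L, so the image of the complement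
   in V/L can be computed on representatives in V. *)
definition contraction_complement ::
    "(complex ^ 'n) set \<Rightarrow> (complex ^ 'n) set \<Rightarrow> ('n \<Rightarrow> complex) set" where
  "contraction_complement V L = complement_image V (vanishing_forms L)"

definition restriction_complement :: "(complex ^ 'n) set \<Rightarrow> ('n \<Rightarrow> complex) set" where
  "restriction_complement L = complement_image L (- vanishing_forms L)"

(* The product of a subset of T^F and a subset of T^(-F), inside T^n. *)
definition torus_product ::
    "'n set \<Rightarrow> ('n \<Rightarrow> complex) set \<Rightarrow> ('n \<Rightarrow> complex) set \<Rightarrow> ('n \<Rightarrow> complex) set" where
  "torus_product F P Q = {\<theta>. restrict \<theta> F \<in> P \<and> restrict \<theta> (- F) \<in> Q}"

end

theory Submission imports Defs begin

text \<open>
  Dividing out scalars means that a sequence in the complement may be rescaled onto the unit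
  sphere of \<open>V\<close> by positive reals, which does not change arguments. Since that sphere is compact, a
  subsequence converges to some nonzero \<open>v \<in> V\<close>, and the sequence can leave every compact
  subset of the projective torus only if some coordinates of \<open>v\<close> vanish. The set \<open>F\<close> of these
  coordinates cuts out a flat \<open>L\<close>, nonzero because it contains \<open>v\<close> and proper because \<open>F\<close> is
  nonempty and no coordinate vanishes on all of \<open>V\<close>. On the coordinates outside \<open>F\<close> the arguments converge to those
  of \<open>v\<close>, a point of the complement of the restriction to \<open>L\<close>; on \<open>F\<close> nothing more is known
  than that they converge, which gives a point in the closure of the coamoeba of the contraction
  (lemma \<open>phase_limit_in_torus_product\<close>).

  Conversely, let \<open>v \<in> L\<close> be nonzero outside \<open>F\<close>, and let \<open>w\<^sub>k \<in> V\<close> have arguments on \<open>F\<close> that converge to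
  a given point of the closure. For \<open>\<epsilon>\<^sub>k > 0\<close> tending to \<open>0\<close> fast enough, the points \<open>v + \<epsilon>\<^sub>k w\<^sub>k\<close> have
  the arguments of \<open>w\<^sub>k\<close> on \<open>F\<close>, where \<open>v\<close> vanishes, and arguments tending to those of \<open>v\<close>
  elsewhere. They leave every compact set, even up to scalars, because the ratio of a coordinate
  in \<open>F\<close> to one outside \<open>F\<close> tends to \<open>0\<close>
  (lemma \<open>torus_product_subset_phase_limit_set\<close>).
\<close>

section \<open>Convergence in a space of functions\<close>

lemma tendsto_fun_iff:
  fixes f :: "'b \<Rightarrow> 'a \<Rightarrow> 'c::topological_space"
  shows "(f \<longlongrightarrow> l) G \<longleftrightarrow> (\<forall>i. ((\<lambda>k. f k i) \<longlongrightarrow> l i) G)"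
  using limitin_componentwise[of "\<lambda>_. euclidean :: 'c topology" "UNIV :: 'a set" f l G]
  by (simp add: euclidean_product_topology)

text \<open>Over a finite index set the products of balls of radius \<open>1 / (k + 1)\<close> around \<open>\<theta>\<close> are open,
  so they meet \<open>S\<close>; any choice of points in these intersections converges coordinatewise.\<close>

lemma closure_fun_sequence:
  fixes S :: "('n::finite \<Rightarrow> 'c::metric_space) set"
  assumes "\<theta> \<in> closure S"
  obtains s where "\<And>k::nat. s k \<in> S" "s \<longlonglongrightarrow> \<theta>"
proof -
  have "\<exists>s. s \<in> S \<and> (\<forall>i. dist (s i) (\<theta> i) < 1 / real (Suc k))" for k
  proof -
    let ?U = "Pi\<^sub>E UNIV (\<lambda>i. ball (\<theta> i) (1 / real (Suc k)))"
    have "open ?U" by (intro open_PiE) auto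
    moreover have "\<theta> \<in> ?U" by (auto simp: PiE_iff)
    ultimately have "S \<inter> ?U \<noteq> {}"
      using assms open_Int_closure_eq_empty[of ?U S] by (metis Int_commute disjoint_iff)
    then obtain s where "s \<in> S" "s \<in> ?U" by blast
    then show ?thesis by (auto simp: PiE_iff dist_commute)
  qed
  then obtain s where s: "\<And>k. s k \<in> S" "\<And>k i. dist (s k i) (\<theta> i) < 1 / real (Suc k)"
    by metis
  have "(\<lambda>k. s k i) \<longlonglongrightarrow> \<theta> i" for i
  proof -
    have "(\<lambda>k. dist (s k i) (\<theta> i)) \<longlonglongrightarrow> 0"
      by (rule Lim_null_comparison[OF _ lim_inverse_n'[THEN LIMSEQ_Suc]])
         (use s(2) in \<open>auto simp: less_imp_le\<close>)
    then show ?thesis by (subst tendsto_dist_iff)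
  qed
  then show thesis using s(1) that by (auto simp: tendsto_fun_iff)
qed

section \<open>Unbounded sequences modulo scalars\<close>

lemma torus_arg_eq_sgn: "torus_arg I z = (\<lambda>i\<in>I. sgn (z i))"
  by (simp add: torus_arg_def sgn_eq)

lemma arrangement_complement_eq:
  "arrangement_complement V = {vec_nth v | v. v \<in> V \<and> (\<forall>i. v $ i \<noteq> 0)}"
  by (simp add: arrangement_complement_def complement_image_def restrict_UNIV)

lemma scale_by_arrangement_complement:
  assumes "vec.subspace V" "c \<noteq> 0"
  shows "scale_by c ` arrangement_complement V = arrangement_complement V"
proof -
  have sub: "scale_by a ` arrangement_complement V \<subseteq> arrangement_complement V" if "a \<noteq> 0" for a
  proof (clarsimp simp: arrangement_complement_eq)
    fix v assume v: "v \<in> V" "\<forall>i. v $ i \<noteq> 0"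
    have "scale_by a (vec_nth v) = vec_nth (a *s v)"
      by (auto simp: scale_by_def)
    then show "\<exists>u. scale_by a (vec_nth v) = vec_nth u \<and> u \<in> V \<and> (\<forall>i. u $ i \<noteq> 0)"
      using v that vec.subspace_scale[OF assms(1)] by (intro exI[of _ "a *s v"]) auto
  qed
  have "scale_by c (scale_by (inverse c) x) = x" for x :: "'a \<Rightarrow> complex"
    using assms(2) by (simp add: scale_by_def fun_eq_iff)
  then have "arrangement_complement V = scale_by c ` scale_by (inverse c) ` arrangement_complement V"
    by (simp add: image_image)
  also have "\<dots> \<subseteq> scale_by c ` arrangement_complement V"
    using sub[of "inverse c"] assms(2) by (intro image_mono) simp
  finally show ?thesis using sub[OF assms(2)] by (intro subset_antisym)
qed

text \<open>The quotient of two coordinates is a continuous nonvanishing function on the torus which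
  scalars do not change, so it is bounded away from \<open>0\<close> on compact sets.\<close>

lemma unbounded_seq_if_ratio_tendsto_0:
  assumes "(\<lambda>k. x k j / x k i) \<longlonglongrightarrow> 0"
  shows "unbounded_seq X x"
  unfolding unbounded_seq_def
proof (intro allI impI)
  fix K :: "('a \<Rightarrow> complex) set" assume K: "compact K \<and> K \<subseteq> algebraic_torus UNIV"
  let ?q = "\<lambda>z :: 'a \<Rightarrow> complex. z j / z i"
  have nz: "z l \<noteq> 0" if "z \<in> K" for z l
    using K that by (auto simp: algebraic_torus_def PiE_iff)
  have "continuous_on K ?q"
    by (intro continuous_on_divide continuous_on_subset[OF continuous_on_product_coordinates])
       (use nz in auto)
  then have "closed (?q ` K)"
    using K compact_continuous_image compact_imp_closed by blast
  moreover have "0 \<notin> ?q ` K" using nz by force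
  ultimately have "\<forall>\<^sub>F k in sequentially. x k j / x k i \<in> - ?q ` K"
    using assms by (intro topological_tendstoD) auto
  then show "\<forall>\<^sub>F k in sequentially.
      \<forall>c. c \<noteq> 0 \<and> scale_by c ` X = X \<longrightarrow> scale_by c (x k) \<notin> K"
  proof eventually_elim
    case (elim k)
    show ?case
    proof (intro allI impI notI)
      fix c assume "c \<noteq> 0 \<and> scale_by c ` X = X" "scale_by c (x k) \<in> K"
      then show False
        using elim imageI[of "scale_by c (x k)" K ?q] by (simp add: scale_by_def)
    qed
  qed
qed

text \<open>The torus is locally compact: a point has a neighbourhood that is a product of closed
  discs avoiding \<open>0\<close>. A rescaled subsequence converging to that point would eventually stay in
  this compact set.\<close>

lemma unbounded_seq_limit_not_in_torus:
  fixes x :: "nat \<Rightarrow> 'n::finite \<Rightarrow> complex"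
  assumes "unbounded_seq X x" "strict_mono r"
    and c: "\<And>k. c k \<noteq> 0" "\<And>k. scale_by (c k) ` X = X"
    and lim: "(\<lambda>k. scale_by (c k) (x (r k))) \<longlonglongrightarrow> z"
  shows "z \<notin> algebraic_torus UNIV"
proof
  assume "z \<in> algebraic_torus UNIV"
  then have z: "z i \<noteq> 0" for i by (auto simp: algebraic_torus_def PiE_iff)
  define K where "K = Pi\<^sub>E UNIV (\<lambda>i. cball (z i) (cmod (z i) / 2))"
  have "compactin euclidean K"
    unfolding K_def euclidean_product_topology[symmetric]
    by (subst compactin_PiE) auto
  then have "compact K" by simp
  moreover have "0 \<notin> cball (z i) (cmod (z i) / 2)" for i
    using z[of i] by simp
  then have "K \<subseteq> algebraic_torus UNIV"
    unfolding K_def algebraic_torus_def by (intro PiE_mono) auto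
  ultimately have ev: "\<forall>\<^sub>F k in sequentially. \<forall>a. a \<noteq> 0 \<and> scale_by a ` X = X \<longrightarrow> scale_by a (x k) \<notin> K"
    using assms(1) by (auto simp: unbounded_seq_def)
  have "\<forall>\<^sub>F k in sequentially. scale_by (c k) (x (r k)) \<notin> K"
    using eventually_subseq[OF assms(2) ev] by eventually_elim (use c in blast)
  moreover have "\<forall>\<^sub>F k in sequentially. \<forall>i. scale_by (c k) (x (r k)) i \<in> cball (z i) (cmod (z i) / 2)"
  proof (rule eventually_all_finite)
    fix i
    have "(\<lambda>k. scale_by (c k) (x (r k)) i) \<longlonglongrightarrow> z i"
      using lim by (simp add: tendsto_fun_iff)
    then have "\<forall>\<^sub>F k in sequentially. scale_by (c k) (x (r k)) i \<in> ball (z i) (cmod (z i) / 2)"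
      using z[of i] by (intro topological_tendstoD) auto
    then show "\<forall>\<^sub>F k in sequentially. scale_by (c k) (x (r k)) i \<in> cball (z i) (cmod (z i) / 2)"
      by eventually_elim auto
  qed
  ultimately have "\<forall>\<^sub>F k in sequentially. False"
    by eventually_elim (auto simp: K_def PiE_iff)
  then show False by simp
qed

section \<open>Flats\<close>

lemma coordinate_flat_in_flats: "{w \<in> V. \<forall>i\<in>F. w $ i = 0} \<in> flats V"
proof -
  have "{w \<in> V. \<forall>i\<in>F. w $ i = 0} = V \<inter> \<Inter> ((\<lambda>i. {v \<in> V. v $ i = 0}) ` F)"
    by auto
  then show ?thesis by (auto simp: flats_def arrangement_def)
qed

lemma vanishing_forms_eq_empty_imp_eq:
  assumes "L \<in> flats V" "vanishing_forms L = {}"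
  shows "L = V"
proof -
  from assms(1) obtain C where C: "C \<subseteq> arrangement V" "L = V \<inter> \<Inter>C"
    by (auto simp: flats_def)
  have "C = {}"
  proof (rule ccontr)
    assume "C \<noteq> {}"
    then obtain i where "{v \<in> V. v $ i = 0} \<in> C" using C(1) by (auto simp: arrangement_def)
    then have "i \<in> vanishing_forms L" using C(2) by (auto simp: vanishing_forms_def)
    then show False using assms(2) by simp
  qed
  then show ?thesis using C by simp
qed

lemma zero_in_flat:
  assumes "vec.subspace V" "L \<in> flats V"
  shows "0 \<in> L"
  using assms vec.subspace_0 by (force simp: flats_def arrangement_def)

lemma closed_vec_subspace:
  fixes V :: "(complex ^ 'n) set"
  assumes "vec.subspace V"
  shows "closed V"
proof (rule closed_subspace)
  have "r *\<^sub>R v = complex_of_real r *s v" for r and v :: "complex ^ 'n"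
    by (simp add: vec_eq_iff scaleR_conv_of_real[where 'a = complex])
  then show "subspace V"
    using assms by (auto simp: subspace_def vec.subspace_def)
qed

section \<open>Limits of arguments and degenerations to flats\<close>

text \<open>The flat is cut out by the coordinates that vanish at a limit of the normalized sequence.\<close>

lemma phase_limit_in_torus_product:
  fixes V :: "(complex ^ 'n) set"
  assumes V: "vec.subspace V" "\<And>i. \<not> V \<subseteq> {v. v $ i = 0}"
    and "\<theta> \<in> phase_limit_set (arrangement_complement V)"
  obtains L where "L \<in> flats V" "L \<noteq> {0}" "L \<noteq> V"
    "\<theta> \<in> torus_product (vanishing_forms L)
         (closure (coamoeba (vanishing_forms L) (contraction_complement V L)))
         (coamoeba (- vanishing_forms L) (restriction_complement L))"
proof -
  obtain x r where x: "\<And>k. x k \<in> arrangement_complement V"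
    and unb: "unbounded_seq (arrangement_complement V) x" and r: "strict_mono (r :: nat \<Rightarrow> nat)"
    and lim\<theta>: "(\<lambda>k. torus_arg UNIV (x (r k))) \<longlonglongrightarrow> \<theta>"
    using assms(3) by (auto simp: phase_limit_set_def)
  have "\<exists>u. u \<in> V \<and> (\<forall>i. u $ i \<noteq> 0) \<and> x k = vec_nth u" for k
    using x[of k] by (auto simp: arrangement_complement_eq)
  then obtain u where u: "\<And>k. u k \<in> V" "\<And>k i. u k $ i \<noteq> 0" "\<And>k. x k = vec_nth (u k)"
    by metis
  have u0: "u k \<noteq> 0" for k using u(2)[of k] by (metis zero_index)
  define a where "a k = inverse (norm (u k))" for k
  have a: "a k > 0" for k using u0 by (simp add: a_def)
  define y where "y k = complex_of_real (a k) *s u k" for k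
  have y_scale: "y k = a k *\<^sub>R u k" for k
    by (simp add: y_def vec_eq_iff scaleR_conv_of_real[where 'a = complex])
  have yV: "y k \<in> V" for k
    unfolding y_def using V(1) u(1) by (rule vec.subspace_scale)
  have y_sgn: "sgn (y k $ i) = sgn (x k i)" for k i
    using a[of k] by (simp add: y_def sgn_mult sgn_of_real u(3))
  have y_nz: "y k $ i \<noteq> 0" for k i using a[of k] u(2) by (simp add: y_def)
  have "\<forall>k. y (r k) \<in> sphere 0 1"
    using u0 by (simp add: y_scale a_def)
  then obtain v q where v: "v \<in> sphere 0 1" and q: "strict_mono (q :: nat \<Rightarrow> nat)"
    and "((\<lambda>k. y (r k)) \<circ> q) \<longlonglongrightarrow> v"
    using compact_sphere[of 0 1] unfolding compact_def by metis
  then have limy: "(\<lambda>k. y (r (q k))) \<longlonglongrightarrow> v" by (simp add: o_def)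
  have vV: "v \<in> V"
    using closed_sequentially[OF closed_vec_subspace[OF V(1)] _ limy] yV by blast
  have "vec_nth v \<notin> algebraic_torus UNIV"
  proof (rule unbounded_seq_limit_not_in_torus[OF unb])
    show "strict_mono (r \<circ> q)" using r q by (rule strict_mono_o)
    show "complex_of_real (a ((r \<circ> q) k)) \<noteq> 0" for k using a[of "r (q k)"] by simp
    then show "scale_by (complex_of_real (a ((r \<circ> q) k))) ` arrangement_complement V
        = arrangement_complement V" for k
      by (rule scale_by_arrangement_complement[OF V(1)])
    have "scale_by (complex_of_real (a ((r \<circ> q) k))) (x ((r \<circ> q) k)) = vec_nth (y (r (q k)))" for k
      by (auto simp: scale_by_def u(3) y_def)
    then show "(\<lambda>k. scale_by (complex_of_real (a ((r \<circ> q) k))) (x ((r \<circ> q) k))) \<longlonglongrightarrow> vec_nth v"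
      using limy by (auto simp: tendsto_fun_iff intro: tendsto_vec_nth)
  qed
  then obtain j where j: "v $ j = 0" by (auto simp: algebraic_torus_def PiE_iff)
  define F where "F = {i. v $ i = 0}"
  define L where "L = {w \<in> V. \<forall>i\<in>F. w $ i = 0}"
  have vL: "v \<in> L" using vV by (simp add: L_def F_def)
  then have vf: "vanishing_forms L = F"
    by (auto simp: vanishing_forms_def L_def F_def)
  have lim_sgn: "(\<lambda>k. sgn (y (r (q k)) $ i)) \<longlonglongrightarrow> \<theta> i" for i
  proof -
    have "(\<lambda>k. torus_arg UNIV (x (r k)) i) \<longlonglongrightarrow> \<theta> i"
      using lim\<theta> by (simp add: tendsto_fun_iff)
    from LIMSEQ_subseq_LIMSEQ[OF this q] show ?thesis
      by (simp add: o_def torus_arg_eq_sgn y_sgn)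
  qed
  have "restrict \<theta> F \<in> closure (coamoeba F (contraction_complement V L))"
  proof (rule Lim_in_closed_set[OF closed_closure])
    have "torus_arg F (\<lambda>i\<in>F. y (r (q k)) $ i) \<in> coamoeba F (contraction_complement V L)" for k
      unfolding coamoeba_def contraction_complement_def complement_image_def vf
      using yV y_nz by blast
    then show "\<forall>\<^sub>F k in sequentially. torus_arg F (\<lambda>i\<in>F. y (r (q k)) $ i)
        \<in> closure (coamoeba F (contraction_complement V L))"
      using closure_subset by (intro always_eventually) blast
    show "(\<lambda>k. torus_arg F (\<lambda>i\<in>F. y (r (q k)) $ i)) \<longlonglongrightarrow> restrict \<theta> F"
      using lim_sgn by (simp add: tendsto_fun_iff torus_arg_eq_sgn)
  qed simp
  moreover have "restrict \<theta> (- F) \<in> coamoeba (- F) (restriction_complement L)"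
  proof -
    have "\<theta> i = sgn (v $ i)" if "i \<notin> F" for i
      using that lim_sgn[of i] tendsto_sgn[OF tendsto_vec_nth[OF limy, of i]]
      by (auto simp: F_def intro: LIMSEQ_unique)
    then have "restrict \<theta> (- F) = torus_arg (- F) (\<lambda>i\<in>- F. v $ i)"
      by (auto simp: torus_arg_eq_sgn)
    moreover have "(\<lambda>i\<in>- F. v $ i) \<in> restriction_complement L"
      using vL unfolding restriction_complement_def complement_image_def vf
      by (auto simp: F_def)
    ultimately show ?thesis by (auto simp: coamoeba_def)
  qed
  moreover have "L \<noteq> {0}" using vL v by auto
  moreover have "L \<noteq> V" using V(2)[of j] j by (auto simp: L_def F_def)
  moreover have "L \<in> flats V" unfolding L_def by (rule coordinate_flat_in_flats)
  ultimately show thesis using that by (simp add: torus_product_def vf)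
qed

text \<open>A phase limit may be prescribed freely on the two factors because moving off a point of
  \<open>L\<close> in a direction of \<open>V\<close> decides the arguments of the coordinates vanishing on \<open>L\<close> and hardly
  changes the others.\<close>

lemma torus_product_subset_phase_limit_set:
  fixes V :: "(complex ^ 'n) set"
  assumes V: "vec.subspace V" and L: "L \<in> flats V" "L \<noteq> {0}" "L \<noteq> V"
  shows "torus_product (vanishing_forms L)
         (closure (coamoeba (vanishing_forms L) (contraction_complement V L)))
         (coamoeba (- vanishing_forms L) (restriction_complement L))
      \<subseteq> phase_limit_set (arrangement_complement V)"
proof
  define F where "F = vanishing_forms L"
  fix \<theta> assume "\<theta> \<in> torus_product (vanishing_forms L)
         (closure (coamoeba (vanishing_forms L) (contraction_complement V L)))
         (coamoeba (- vanishing_forms L) (restriction_complement L))"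
  then have \<theta>: "restrict \<theta> F \<in> closure (coamoeba F (complement_image V F))"
      "restrict \<theta> (- F) \<in> coamoeba (- F) (complement_image L (- F))"
    by (auto simp: torus_product_def F_def contraction_complement_def restriction_complement_def)
  obtain v where v: "v \<in> L" "\<And>i. i \<notin> F \<Longrightarrow> v $ i \<noteq> 0" "\<And>i. i \<notin> F \<Longrightarrow> \<theta> i = sgn (v $ i)"
  proof -
    obtain v where "v \<in> L" "\<forall>i\<in>- F. v $ i \<noteq> 0"
      and eq: "restrict \<theta> (- F) = torus_arg (- F) (\<lambda>i\<in>- F. v $ i)"
      using \<theta>(2) by (auto simp: coamoeba_def complement_image_def)
    moreover have "\<theta> i = sgn (v $ i)" if "i \<notin> F" for i
      using fun_cong[OF eq, of i] that by (simp add: torus_arg_eq_sgn)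
    ultimately show thesis using that by blast
  qed
  have vV: "v \<in> V" using v(1) L(1) by (auto simp: flats_def)
  have vF: "v $ i = 0" if "i \<in> F" for i using that v(1) by (auto simp: F_def vanishing_forms_def)
  obtain j where j: "j \<in> F" using vanishing_forms_eq_empty_imp_eq[OF L(1)] L(3) F_def by blast
  obtain i0 where i0: "i0 \<notin> F"
  proof -
    obtain u where "u \<in> L" "u \<noteq> 0" using L(2) zero_in_flat[OF V L(1)] by blast
    then show thesis using that by (auto simp: F_def vanishing_forms_def vec_eq_iff)
  qed
  obtain s where s: "\<And>k. s k \<in> coamoeba F (complement_image V F)" "s \<longlonglongrightarrow> restrict \<theta> F"
    using closure_fun_sequence[OF \<theta>(1)] by metis
  have "\<exists>w. w \<in> V \<and> (\<forall>i\<in>F. w $ i \<noteq> 0 \<and> s k i = sgn (w $ i))" for k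
    using s(1)[of k] by (auto simp: coamoeba_def complement_image_def torus_arg_eq_sgn)
  then obtain w where w: "\<And>k. w k \<in> V" "\<And>k i. i \<in> F \<Longrightarrow> w k $ i \<noteq> 0"
      "\<And>k i. i \<in> F \<Longrightarrow> s k i = sgn (w k $ i)"
    by metis
  have lim_w: "(\<lambda>k. sgn (w k $ i)) \<longlonglongrightarrow> \<theta> i" if "i \<in> F" for i
  proof -
    have "(\<lambda>k. s k i) \<longlonglongrightarrow> restrict \<theta> F i" using s(2) by (simp add: tendsto_fun_iff)
    then show ?thesis using that w(3) by simp
  qed
  \<comment> \<open>A displacement of \<open>v\<close> shorter than \<open>\<delta>\<close> leaves the coordinates outside \<open>F\<close> nonzero.\<close>
  define \<delta> where "\<delta> = Min ((\<lambda>i. cmod (v $ i)) ` (- F))"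
  have "\<delta> \<in> (\<lambda>i. cmod (v $ i)) ` (- F)"
    unfolding \<delta>_def using i0 by (intro Min_in) auto
  then have \<delta>: "\<delta> > 0" "\<And>i. i \<notin> F \<Longrightarrow> \<delta> \<le> cmod (v $ i)"
    using v(2) by (auto simp: \<delta>_def)
  \<comment> \<open>The double successor makes already the first displacement strictly shorter than \<open>\<delta>\<close>.\<close>
  define e where "e k = \<delta> / (real (Suc (Suc k)) * (1 + norm (w k)))" for k
  have wpos: "1 + norm (w k) > 0" for k by (smt (verit) norm_ge_zero)
  have e: "e k > 0" for k using \<delta>(1) wpos by (simp add: e_def)
  define y where "y k = v + complex_of_real (e k) *s w k" for k
  have yV: "y k \<in> V" for k
    unfolding y_def by (intro vec.subspace_add vec.subspace_scale V vV w(1))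
  have yF: "y k $ i = complex_of_real (e k) * w k $ i" if "i \<in> F" for k i
    using that by (simp add: y_def vF)
  have dist: "cmod (y k $ i - v $ i) \<le> \<delta> / real (Suc (Suc k))" for k i
  proof -
    have "cmod (y k $ i - v $ i) = e k * cmod (w k $ i)"
      using e[of k] by (simp add: y_def norm_mult)
    also have "\<dots> \<le> e k * (1 + norm (w k))"
      using e[of k] Finite_Cartesian_Product.norm_nth_le[of "w k" i]
      by (intro mult_left_mono) auto
    also have "\<dots> = \<delta> / real (Suc (Suc k))" using wpos[of k] by (simp add: e_def)
    finally show ?thesis .
  qed
  have lim_y: "(\<lambda>k. y k $ i) \<longlonglongrightarrow> v $ i" for i
  proof -
    have "(\<lambda>k. \<delta> / real (Suc (Suc k))) \<longlonglongrightarrow> 0"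
      using LIMSEQ_Suc[OF LIMSEQ_Suc[OF lim_const_over_n[of \<delta>]]] by simp
    then have "(\<lambda>k. y k $ i - v $ i) \<longlonglongrightarrow> 0"
      by (rule Lim_null_comparison[rotated]) (intro always_eventually allI dist)
    then show ?thesis by (simp add: LIM_zero_iff)
  qed
  have y_nz: "y k $ i \<noteq> 0" for k i
  proof (cases "i \<in> F")
    case True
    then show ?thesis using e[of k] w(2) by (simp add: yF)
  next
    case False
    have "\<delta> / real (Suc (Suc k)) < \<delta> / 1" using \<delta>(1) by (intro divide_strict_left_mono) auto
    then have "cmod (y k $ i - v $ i) < cmod (v $ i)" using dist[of k i] \<delta>(2)[OF False] by simp
    then show ?thesis by auto
  qed
  have "vec_nth (y k) \<in> arrangement_complement V" for k
    using yV y_nz by (auto simp: arrangement_complement_eq)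
  moreover have "unbounded_seq (arrangement_complement V) (\<lambda>k. vec_nth (y k))"
  proof (rule unbounded_seq_if_ratio_tendsto_0)
    show "(\<lambda>k. y k $ j / y k $ i0) \<longlonglongrightarrow> 0"
      using tendsto_divide[OF lim_y[of j] lim_y[of i0] v(2)[OF i0]] vF[OF j] by simp
  qed
  moreover have "(\<lambda>k. torus_arg UNIV (vec_nth (y k))) \<longlonglongrightarrow> \<theta>"
  proof -
    have "(\<lambda>k. sgn (y k $ i)) \<longlonglongrightarrow> \<theta> i" for i
    proof (cases "i \<in> F")
      case True
      have "sgn (y k $ i) = sgn (w k $ i)" for k
        using e[of k] by (simp add: yF[OF True] sgn_mult sgn_of_real)
      then show ?thesis using lim_w[OF True] by simp
    next
      case False
      then show ?thesis using tendsto_sgn[OF lim_y[of i] v(2)] v(3) by simp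
    qed
    then show ?thesis by (simp add: tendsto_fun_iff torus_arg_eq_sgn)
  qed
  ultimately show "\<theta> \<in> phase_limit_set (arrangement_complement V)"
    unfolding phase_limit_set_def mem_Collect_eq
    by (intro exI[of _ "\<lambda>k. vec_nth (y k)"] exI[of _ "id :: nat \<Rightarrow> nat"])
       (simp add: strict_mono_def)
qed

theorem theorem2p3:
  fixes V :: "(complex ^ 'n) set"
  assumes "vec.subspace V"
    and "\<And>i. \<not> V \<subseteq> {v. v $ i = 0}"
  shows "phase_limit_set (arrangement_complement V) =
    (\<Union>L \<in> {L \<in> flats V. L \<noteq> {0} \<and> L \<noteq> V}.
       torus_product (vanishing_forms L)
         (closure (coamoeba (vanishing_forms L) (contraction_complement V L)))
         (coamoeba (- vanishing_forms L) (restriction_complement L)))"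
  (is "_ = (\<Union>L \<in> ?flats. ?product L)")
proof (rule subset_antisym; rule subsetI)
  fix \<theta> assume "\<theta> \<in> phase_limit_set (arrangement_complement V)"
  from phase_limit_in_torus_product[OF assms this]
  obtain L where "L \<in> ?flats" "\<theta> \<in> ?product L" by blast
  then show "\<theta> \<in> (\<Union>L \<in> ?flats. ?product L)" by (rule UN_I)
next
  fix \<theta> assume "\<theta> \<in> (\<Union>L \<in> ?flats. ?product L)"
  then obtain L where "L \<in> ?flats" "\<theta> \<in> ?product L" by (rule UN_E)
  then show "\<theta> \<in> phase_limit_set (arrangement_complement V)"
    using torus_product_subset_phase_limit_set[OF assms(1)] by blast
qed

end
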